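(* Let $G$ be a three-dimensional unimodular Lie group with a left-invariant Lorentzian metric whose metric Lie algebra is of type $\mathcal{A}_2$ (with parameters $\lambda_1,\lambda_2\in\mathbb{R}$) or of type $\mathcal{A}_3$ (with parameter $\lambda\in\mathbb{R}$), and suppose that the Schouten--Weyl tensor $SW$ of $G$ is isotropic, i.e. $\|SW\|^2=0$ and $SW\neq 0$. Then the Lie algebra of $G$ is isomorphic to $e(1,1)$ or $sl(2,\mathbb{R})$, and more precisely one of the following holds: (1) the metric Lie algebra is of type $\mathcal{A}_2$ with $\lambda_1=0$, $\lambda_2\neq 0$, and the Lie algebra is isomorphic to $e(1,1)$; (2) the metric Lie algebra is of type $\mathcal{A}_2$ with $\lambda_1=\lambda_2\neq 0$, and the Lie algebra is isomorphic to $sl(2,\mathbb{R})$; (3) the metric Lie algebra is of type $\mathcal{A}_3$ with $\lambda\neq 0$, and the Lie algebra is isomorphic to $sl(2,\mathbb{R})$.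
   Context: A left-invariant Lorentzian metric $\langle\cdot,\cdot\rangle$ on a Lie group $G$ is identified with an inner product of Lorentzian signature on its Lie algebra $\mathfrak{g}$. The metric Lie algebra is of type $\mathcal{A}_2$ or $\mathcal{A}_3$ if there is a pseudo-orthonormal basis $\{e_1,e_2,e_3\}$ of $\mathfrak{g}$, with $e_3$ timelike (so $\langle e_1,e_1\rangle=\langle e_2,e_2\rangle=1$, $\langle e_3,e_3\rangle=-1$, other products zero), such that, respectively: $\mathcal{A}_2$: $[e_1,e_2]=(1-\lambda_2)e_3-e_2$, $[e_1,e_3]=e_3-(1+\lambda_2)e_2$, $[e_2,e_3]=\lambda_1e_1$; $\mathcal{A}_3$: $[e_1,e_2]=e_1-\lambda e_3$, $[e_1,e_3]=-\lambda e_2-e_1$, $[e_2,e_3]=\lambda e_1+e_2+e_3$. Here $e(1,1)$ is the Lie algebra of the group of rigid motions of the Minkowski plane. Let $\nabla$ be the Levi-Civita connection, $R(X,Y)Z=[\nabla_Y,\nabla_X]Z+\nabla_{[X,Y]}Z$ the curvature tensor, $r(X,Y)=\mathrm{tr}(Z\mapsto R(X,Z)Y)$ the Ricci tensor, $\rho$ the scalar curvature, and $g_{ij}$ the components of the metric. With $n=\dim G=3$, the one-dimensional curvature tensor $A$ and the Schouten--Weyl tensor $SW$ are $$A_{ik}=\frac{1}{n-2}\left(r_{ik}-\frac{\rho g_{ik}}{2(n-1)}\right),\qquad SW_{ijk}=A_{ij,k}-A_{ik,j},$$ where $A_{ij,k}$ are the components of the covariant derivative of $A$ (the index after the comma is the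 direction of differentiation). The squared length is $\|SW\|^2=SW_{ijk}SW^{ijk}$, indices being raised with the metric. *)

theory Defs
  imports "HOL-Analysis.Analysis"
begin

section \<open>Real Lie algebras\<close>

text \<open>
  An abstract Lie algebra is a bracket on a whole type of class \<^class>\<open>real_vector\<close>;
  the model algebras below are subspaces of matrix types with the commutator.
\<close>

definition lie_algebra :: "('a::real_vector \<Rightarrow> 'a \<Rightarrow> 'a) \<Rightarrow> bool" where
  "lie_algebra br \<longleftrightarrow>
     bilinear br \<and> (\<forall>x. br x x = 0) \<and>
     (\<forall>x y z. br x (br y z) + br y (br z x) + br z (br x y) = 0)"

definition endo_trace :: "('a::real_vector \<Rightarrow> 'a) \<Rightarrow> real" where
  "endo_trace f =
     (let B = (SOME B. independent B \<and> span B = UNIV)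
      in \<Sum>b\<in>B. representation B (f b) b)"

text \<open>A connected Lie group is unimodular iff all \<open>ad x\<close> are traceless.\<close>

definition unimodular :: "('a::real_vector \<Rightarrow> 'a \<Rightarrow> 'a) \<Rightarrow> bool" where
  "unimodular br \<longleftrightarrow> (\<forall>x. endo_trace (br x) = 0)"

definition commutator :: "real^'n^'n \<Rightarrow> real^'n^'n \<Rightarrow> real^'n^'n" where
  "commutator X Y = X ** Y - Y ** X"

definition sl2 :: "(real^2^2) set" where
  "sl2 = {X. trace X = 0}"

text \<open>
  A rigid motion \<open>v \<mapsto> L v + w\<close> of the Minkowski plane acts on homogeneous coordinates
  \<open>(v, 1)\<close> as a \<open>3 \<times> 3\<close> matrix. Differentiating at the identity gives an infinitesimal boost
  with parameter \<open>t\<close> and a translation part \<open>(x, y)\<close>.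
\<close>

definition e11 :: "(real^3^3) set" where
  "e11 = {vector [vector [0, t, x], vector [t, 0, y], vector [0, 0, 0]] | t x y. True}"

definition lie_isomorphic_to ::
  "('a::real_vector \<Rightarrow> 'a \<Rightarrow> 'a) \<Rightarrow> (real^'n^'n) set \<Rightarrow> bool" where
  "lie_isomorphic_to br S \<longleftrightarrow>
     (\<exists>f. linear f \<and> bij_betw f UNIV S \<and> (\<forall>x y. f (br x y) = commutator (f x) (f y)))"

section \<open>Lorentzian inner products in dimension three\<close>

definition pseudo_orthonormal_basis ::
  "('a::real_vector \<Rightarrow> 'a \<Rightarrow> real) \<Rightarrow> 'a \<Rightarrow> 'a \<Rightarrow> 'a \<Rightarrow> bool" where
  "pseudo_orthonormal_basis g e1 e2 e3 \<longleftrightarrow>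
     independent {e1, e2, e3} \<and> span {e1, e2, e3} = UNIV \<and>
     g e1 e1 = 1 \<and> g e2 e2 = 1 \<and> g e3 e3 = -1 \<and>
     g e1 e2 = 0 \<and> g e1 e3 = 0 \<and> g e2 e3 = 0"

definition lorentzian :: "('a::real_vector \<Rightarrow> 'a \<Rightarrow> real) \<Rightarrow> bool" where
  "lorentzian g \<longleftrightarrow>
     bilinear g \<and> (\<forall>x y. g x y = g y x) \<and>
     (\<exists>e1 e2 e3. pseudo_orthonormal_basis g e1 e2 e3)"

definition type_A2 ::
  "('a::real_vector \<Rightarrow> 'a \<Rightarrow> 'a) \<Rightarrow> ('a \<Rightarrow> 'a \<Rightarrow> real) \<Rightarrow> real \<Rightarrow> real \<Rightarrow> bool" where
  "type_A2 br g l1 l2 \<longleftrightarrow>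
     (\<exists>e1 e2 e3. pseudo_orthonormal_basis g e1 e2 e3 \<and>
        br e1 e2 = (1 - l2) *\<^sub>R e3 - e2 \<and>
        br e1 e3 = e3 - (1 + l2) *\<^sub>R e2 \<and>
        br e2 e3 = l1 *\<^sub>R e1)"

definition type_A3 ::
  "('a::real_vector \<Rightarrow> 'a \<Rightarrow> 'a) \<Rightarrow> ('a \<Rightarrow> 'a \<Rightarrow> real) \<Rightarrow> real \<Rightarrow> bool" where
  "type_A3 br g l \<longleftrightarrow>
     (\<exists>e1 e2 e3. pseudo_orthonormal_basis g e1 e2 e3 \<and>
        br e1 e2 = e1 - l *\<^sub>R e3 \<and>
        br e1 e3 = - (l *\<^sub>R e2) - e1 \<and>
        br e2 e3 = l *\<^sub>R e1 + e2 + e3)"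

section \<open>Curvature of a metric Lie algebra\<close>

text \<open>
  All tensors are left-invariant, hence given by multilinear maps on the Lie algebra.
  Left-invariant functions are constant, so their derivatives drop out of the metric
  condition on the connection and of the covariant derivative of a tensor.
\<close>

definition is_levi_civita ::
  "('a::real_vector \<Rightarrow> 'a \<Rightarrow> 'a) \<Rightarrow> ('a \<Rightarrow> 'a \<Rightarrow> real) \<Rightarrow> ('a \<Rightarrow> 'a \<Rightarrow> 'a) \<Rightarrow> bool" where
  "is_levi_civita br g D \<longleftrightarrow>
     bilinear D \<and> (\<forall>x y. D x y - D y x = br x y) \<and>
     (\<forall>x y z. g (D x y) z + g y (D x z) = 0)"

definition levi_civita ::
  "('a::real_vector \<Rightarrow> 'a \<Rightarrow> 'a) \<Rightarrow> ('a \<Rightarrow> 'a \<Rightarrow> real) \<Rightarrow> 'a \<Rightarrow> 'a \<Rightarrow> 'a" where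
  "levi_civita br g = (THE D. is_levi_civita br g D)"

definition curvature ::
  "('a::real_vector \<Rightarrow> 'a \<Rightarrow> 'a) \<Rightarrow> ('a \<Rightarrow> 'a \<Rightarrow> real) \<Rightarrow> 'a \<Rightarrow> 'a \<Rightarrow> 'a \<Rightarrow> 'a" where
  "curvature br g x y z =
     (let D = levi_civita br g in D y (D x z) - D x (D y z) + D (br x y) z)"

definition ricci ::
  "('a::real_vector \<Rightarrow> 'a \<Rightarrow> 'a) \<Rightarrow> ('a \<Rightarrow> 'a \<Rightarrow> real) \<Rightarrow> 'a \<Rightarrow> 'a \<Rightarrow> real" where
  "ricci br g x y = endo_trace (\<lambda>z. curvature br g x z y)"

definition sharp :: "('a::real_vector \<Rightarrow> 'a \<Rightarrow> real) \<Rightarrow> ('a \<Rightarrow> real) \<Rightarrow> 'a" where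
  "sharp g \<phi> = (THE v. \<forall>w. g v w = \<phi> w)"

text \<open>
  The full contraction \<open>g\<^sup>i\<^sup>j S\<^sub>i\<^sub>j\<close> of a bilinear form: one index is raised with the metric
  and the resulting endomorphism is traced.
\<close>

definition metric_trace ::
  "('a::real_vector \<Rightarrow> 'a \<Rightarrow> real) \<Rightarrow> ('a \<Rightarrow> 'a \<Rightarrow> real) \<Rightarrow> real" where
  "metric_trace g S = endo_trace (\<lambda>x. sharp g (S x))"

definition scalar_curvature ::
  "('a::real_vector \<Rightarrow> 'a \<Rightarrow> 'a) \<Rightarrow> ('a \<Rightarrow> 'a \<Rightarrow> real) \<Rightarrow> real" where
  "scalar_curvature br g = metric_trace g (ricci br g)"

definition curvature_A ::
  "('a::real_vector \<Rightarrow> 'a \<Rightarrow> 'a) \<Rightarrow> ('a \<Rightarrow> 'a \<Rightarrow> real) \<Rightarrow> 'a \<Rightarrow> 'a \<Rightarrow> real" where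
  "curvature_A br g x y =
     (let n = real (dim (UNIV :: 'a set))
      in 1 / (n - 2) *
         (ricci br g x y - scalar_curvature br g * g x y / (2 * (n - 1))))"

text \<open>The last argument is the direction of differentiation: \<open>T\<^sub>i\<^sub>j\<^sub>,\<^sub>k\<close> is
  \<open>cov_deriv br g T e\<^sub>i e\<^sub>j e\<^sub>k\<close>.\<close>

definition cov_deriv ::
  "('a::real_vector \<Rightarrow> 'a \<Rightarrow> 'a) \<Rightarrow> ('a \<Rightarrow> 'a \<Rightarrow> real) \<Rightarrow> ('a \<Rightarrow> 'a \<Rightarrow> real) \<Rightarrow>
   'a \<Rightarrow> 'a \<Rightarrow> 'a \<Rightarrow> real" where
  "cov_deriv br g T x y z =
     - T (levi_civita br g z x) y - T x (levi_civita br g z y)"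

definition schouten_weyl ::
  "('a::real_vector \<Rightarrow> 'a \<Rightarrow> 'a) \<Rightarrow> ('a \<Rightarrow> 'a \<Rightarrow> real) \<Rightarrow> 'a \<Rightarrow> 'a \<Rightarrow> 'a \<Rightarrow> real" where
  "schouten_weyl br g x y z =
     cov_deriv br g (curvature_A br g) x y z - cov_deriv br g (curvature_A br g) x z y"

text \<open>\<open>g\<^sup>i\<^sup>l g\<^sup>j\<^sup>m g\<^sup>k\<^sup>n T\<^sub>i\<^sub>j\<^sub>k T\<^sub>l\<^sub>m\<^sub>n\<close>\<close>

definition sq_length3 ::
  "('a::real_vector \<Rightarrow> 'a \<Rightarrow> real) \<Rightarrow> ('a \<Rightarrow> 'a \<Rightarrow> 'a \<Rightarrow> real) \<Rightarrow> real" where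
  "sq_length3 g T =
     metric_trace g (\<lambda>x x'. metric_trace g (\<lambda>y y'. metric_trace g (\<lambda>z z'.
       T x y z * T x' y' z')))"

definition isotropic3 ::
  "('a::real_vector \<Rightarrow> 'a \<Rightarrow> real) \<Rightarrow> ('a \<Rightarrow> 'a \<Rightarrow> 'a \<Rightarrow> real) \<Rightarrow> bool" where
  "isotropic3 g T \<longleftrightarrow> sq_length3 g T = 0 \<and> T \<noteq> (\<lambda>x y z. 0)"

end

theory Submission
  imports Defs
begin

text \<open>
  In a pseudo-orthonormal frame all traces become signed sums of frame components and the
  Koszul formula gives the Levi-Civita connection. For type \<open>A2\<close> one finds
  \<open>\<parallel>SW\<parallel>\<^sup>2 = - 3 l1\<^sup>4 (l1 - l2)\<^sup>2\<close>, and \<open>SW = 0\<close> if \<open>l1 = l2 = 0\<close>. For type \<open>A3\<close> the length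
  \<open>\<parallel>SW\<parallel>\<^sup>2\<close> vanishes identically, and \<open>SW = 0\<close> if \<open>l = 0\<close>. In each remaining case \<open>ad e1\<close> has
  eigenvalues \<open>0, \<plusminus>\<mu>\<close> with \<open>\<mu> \<noteq> 0\<close>, and an eigenbasis yields the isomorphism with \<open>e(1,1)\<close> or
  \<open>sl(2,\<real>)\<close>.
\<close>

section \<open>Independence of the trace from the basis\<close>

lemma endo_trace_eq_basis:
  fixes f :: "'a::real_vector \<Rightarrow> 'a"
  assumes f: "linear f" and C: "independent C" "span C = UNIV" "finite C"
  shows "endo_trace f = (\<Sum>c\<in>C. representation C (f c) c)"
proof -
  define B :: "'a set" where "B = (SOME B. independent B \<and> span B = UNIV)"
  \<comment> \<open>\<open>endo_trace\<close> rests on an arbitrary choice of basis; the given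
    \<open>C\<close> shows that the choice is of an actual basis.\<close>
  have "independent B \<and> span B = UNIV"
    unfolding B_def by (rule someI[where x = C]) (use C in blast)
  then have B: "independent B" "span B = UNIV" by auto
  have fB: "finite B"
    using independent_span_bound[of C B] B C by auto
  have inB: "x \<in> span B" and inC: "x \<in> span C" for x
    using B C by auto
  have "endo_trace f = (\<Sum>b\<in>B. representation B (f b) b)"
    by (simp add: endo_trace_def B_def Let_def)
  \<comment> \<open>Expanding \<open>b\<close> in \<open>C\<close> gives a double sum over
    \<open>B\<close> and \<open>C\<close>; summed over \<open>b\<close> first, it becomes the trace
    in \<open>C\<close>, since its coefficients re-expand \<open>f c\<close> in
    \<open>B\<close>.\<close>
  also have "\<dots> = (\<Sum>b\<in>B. \<Sum>c\<in>C. representation C b c * representation B (f c) b)"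
  proof (rule sum.cong[OF refl])
    fix b
    have "f b = f (\<Sum>c\<in>C. representation C b c *\<^sub>R c)"
      by (simp add: sum_representation_eq C)
    also have "\<dots> = (\<Sum>c\<in>C. representation C b c *\<^sub>R f c)"
      by (simp add: linear_sum[OF f] linear_scale[OF f])
    finally have *: "f b = (\<Sum>c\<in>C. representation C b c *\<^sub>R f c)" .
    show "representation B (f b) b = (\<Sum>c\<in>C. representation C b c * representation B (f c) b)"
      unfolding * by (simp add: representation_sum representation_scale B)
  qed
  also have "\<dots> = (\<Sum>c\<in>C. \<Sum>b\<in>B. representation B (f c) b * representation C b c)"
    by (subst sum.swap) (simp add: mult.commute)
  also have "\<dots> = (\<Sum>c\<in>C. representation C (f c) c)"
  proof (rule sum.cong[OF refl])
    fix c
    have "f c = (\<Sum>b\<in>B. representation B (f c) b *\<^sub>R b)"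
      by (simp add: sum_representation_eq B fB)
    then have "representation C (f c) c
        = representation C (\<Sum>b\<in>B. representation B (f c) b *\<^sub>R b) c" by simp
    then show "(\<Sum>b\<in>B. representation B (f c) b * representation C b c) = representation C (f c) c"
      by (simp add: representation_sum representation_scale C)
  qed
  finally show ?thesis .
qed

section \<open>Expansions, traces and index raising in a pseudo-orthonormal frame\<close>

lemmas bilinear_simps = bilinear_ladd bilinear_radd bilinear_lmul bilinear_rmul
  bilinear_lneg bilinear_rneg bilinear_lsub bilinear_rsub bilinear_lzero bilinear_rzero

locale lorentz_frame =
  fixes g :: "'a::real_vector \<Rightarrow> 'a \<Rightarrow> real" and e1 e2 e3 :: 'a
  assumes bilinear_g: "bilinear g"
    and g_sym: "g x y = g y x"
    and frame: "pseudo_orthonormal_basis g e1 e2 e3"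
begin

lemmas g_simps = bilinear_simps[OF bilinear_g]

lemma g_frame [simp]:
  "g e1 e1 = 1" "g e2 e2 = 1" "g e3 e3 = -1"
  "g e1 e2 = 0" "g e1 e3 = 0" "g e2 e3 = 0" "g e2 e1 = 0" "g e3 e1 = 0" "g e3 e2 = 0"
  using frame g_sym unfolding pseudo_orthonormal_basis_def by metis+

text \<open>The minus sign is \<open>g e3 e3 = -1\<close>: the \<open>e3\<close>-coordinate of
  \<open>x\<close> is \<open>- g x e3\<close>.\<close>

lemma frame_expansion: "x = g x e1 *\<^sub>R e1 + g x e2 *\<^sub>R e2 - g x e3 *\<^sub>R e3"
proof -
  have "x \<in> span {e1, e2, e3}"
    using frame by (simp add: pseudo_orthonormal_basis_def)
  then obtain a b c where "x - a *\<^sub>R e1 - b *\<^sub>R e2 - c *\<^sub>R e3 = 0"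
    by (auto simp: span_breakdown_eq)
  then have x: "x = a *\<^sub>R e1 + b *\<^sub>R e2 + c *\<^sub>R e3"
    by (simp add: algebra_simps)
  show ?thesis
    by (simp add: x g_simps)
qed

lemma frame_eqI:
  assumes "g x e1 = g y e1" "g x e2 = g y e2" "g x e3 = g y e3"
  shows "x = y"
  using frame_expansion[of x] frame_expansion[of y] assms by simp

lemma linear_expansion:
  fixes f :: "'a \<Rightarrow> 'b::real_vector"
  assumes "linear f"
  shows "f x = g x e1 *\<^sub>R f e1 + g x e2 *\<^sub>R f e2 - g x e3 *\<^sub>R f e3"
  by (subst frame_expansion[of x])
    (simp add: linear_add[OF assms] linear_diff[OF assms] linear_scale[OF assms])

lemma linear_frame_eqI:
  fixes f h :: "'a \<Rightarrow> 'b::real_vector"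
  assumes "linear f" "linear h" "f e1 = h e1" "f e2 = h e2" "f e3 = h e3"
  shows "f x = h x"
  using linear_expansion[OF assms(1), of x] linear_expansion[OF assms(2), of x] assms(3-) by simp

lemma endo_trace_frame:
  assumes "linear f"
  shows "endo_trace f = g (f e1) e1 + g (f e2) e2 - g (f e3) e3"
proof -
  let ?C = "{e1, e2, e3}"
  have C: "independent ?C" "span ?C = UNIV"
    using frame by (auto simp: pseudo_orthonormal_basis_def)
  have inC: "x \<in> span ?C" for x
    using C by simp
  \<comment> \<open>Distinctness makes the sum over the set \<open>{e1, e2, e3}\<close> a sum of
    three terms.\<close>
  have ne: "e1 \<noteq> e2" "e1 \<noteq> e3" "e2 \<noteq> e3"
    using g_frame by fastforce+
  have rep: "representation ?C x c = g x e1 * representation ?C e1 c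
      + g x e2 * representation ?C e2 c - g x e3 * representation ?C e3 c" for x c
    by (subst frame_expansion[of x])
      (simp only: representation_add[OF C(1) inC inC] representation_diff[OF C(1) inC inC]
        representation_scale[OF C(1) inC])
  have basis: "representation ?C e1 = (\<lambda>v. if v = e1 then 1 else 0)"
    "representation ?C e2 = (\<lambda>v. if v = e2 then 1 else 0)"
    "representation ?C e3 = (\<lambda>v. if v = e3 then 1 else 0)"
    using C(1) by (simp_all add: representation_basis)
  have "endo_trace f = (\<Sum>c\<in>?C. representation ?C (f c) c)"
    by (rule endo_trace_eq_basis) (use assms C in auto)
  also have "\<dots> = g (f e1) e1 + g (f e2) e2 - g (f e3) e3"
    by (simp add: ne ne[symmetric] rep[of "f e1"] rep[of "f e2"] rep[of "f e3"] basis)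
  finally show ?thesis .
qed

text \<open>Nondegeneracy of \<open>g\<close> enters through \<open>frame_expansion\<close>: a
  vector is determined by its products with the frame, so the description in \<open>sharp\<close>
  has a unique solution.\<close>

lemma sharp_eq:
  assumes "linear \<phi>"
  shows "sharp g \<phi> = \<phi> e1 *\<^sub>R e1 + \<phi> e2 *\<^sub>R e2 - \<phi> e3 *\<^sub>R e3"
  unfolding sharp_def
proof (rule the_equality)
  show "\<forall>w. g (\<phi> e1 *\<^sub>R e1 + \<phi> e2 *\<^sub>R e2 - \<phi> e3 *\<^sub>R e3) w = \<phi> w"
  proof
    fix w
    show "g (\<phi> e1 *\<^sub>R e1 + \<phi> e2 *\<^sub>R e2 - \<phi> e3 *\<^sub>R e3) w = \<phi> w"
      using linear_expansion[OF assms, of w]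
      by (simp add: g_simps g_sym[of _ w] mult.commute)
  qed
  show "v = \<phi> e1 *\<^sub>R e1 + \<phi> e2 *\<^sub>R e2 - \<phi> e3 *\<^sub>R e3" if "\<forall>w. g v w = \<phi> w" for v
    using that frame_expansion[of v] by simp
qed

lemma metric_trace_eq:
  assumes "bilinear S"
  shows "metric_trace g S = S e1 e1 + S e2 e2 - S e3 e3"
proof -
  have lin: "linear (S x)" "linear (\<lambda>x. S x y)" for x y
    using assms by (auto simp: bilinear_def)
  have eq: "(\<lambda>x. sharp g (S x)) = (\<lambda>x. S x e1 *\<^sub>R e1 + S x e2 *\<^sub>R e2 - S x e3 *\<^sub>R e3)"
    using sharp_eq[OF lin(1)] by blast
  have "linear (\<lambda>x. S x e1 *\<^sub>R e1 + S x e2 *\<^sub>R e2 - S x e3 *\<^sub>R e3)"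
    by (rule linearI) (simp_all add: bilinear_simps[OF assms] algebra_simps)
  then show ?thesis
    unfolding metric_trace_def eq by (simp add: endo_trace_frame g_simps)
qed

end

section \<open>Trilinear maps and their squared length\<close>

definition trilinear :: "('a::real_vector \<Rightarrow> 'a \<Rightarrow> 'a \<Rightarrow> 'b::real_vector) \<Rightarrow> bool" where
  "trilinear T \<longleftrightarrow> (\<forall>y z. linear (\<lambda>x. T x y z)) \<and> (\<forall>x z. linear (\<lambda>y. T x y z)) \<and>
     (\<forall>x y. linear (\<lambda>z. T x y z))"

lemma bilinearI:
  assumes "\<And>x y z. h (x + y) z = h x z + h y z" "\<And>c x z. h (c *\<^sub>R x) z = c *\<^sub>R h x z"
    "\<And>x y z. h x (y + z) = h x y + h x z" "\<And>c x z. h x (c *\<^sub>R z) = c *\<^sub>R h x z"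
  shows "bilinear h"
  unfolding bilinear_def using assms by (auto intro!: linearI)

lemma trilinearI:
  assumes "\<And>x x' y z. T (x + x') y z = T x y z + T x' y z"
    "\<And>c x y z. T (c *\<^sub>R x) y z = c *\<^sub>R T x y z"
    "\<And>x y y' z. T x (y + y') z = T x y z + T x y' z"
    "\<And>c x y z. T x (c *\<^sub>R y) z = c *\<^sub>R T x y z"
    "\<And>x y z z'. T x y (z + z') = T x y z + T x y z'"
    "\<And>c x y z. T x y (c *\<^sub>R z) = c *\<^sub>R T x y z"
  shows "trilinear T"
  unfolding trilinear_def using assms by (auto intro!: linearI)

lemma trilinearD:
  assumes "trilinear T"
  shows "T (x + x') y z = T x y z + T x' y z"
    "T (c *\<^sub>R x) y z = c *\<^sub>R T x y z"
    "T x (y + y') z = T x y z + T x y' z"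
    "T x (c *\<^sub>R y) z = c *\<^sub>R T x y z"
    "T x y (z + z') = T x y z + T x y z'"
    "T x y (c *\<^sub>R z) = c *\<^sub>R T x y z"
  using assms linear_add linear_scale unfolding trilinear_def linear_iff by blast+

context lorentz_frame
begin

text \<open>The three metric traces are evaluated from the inside out, each after checking
  bilinearity in the pair of slots being contracted. Every index \<open>e3\<close> contributes a
  factor -1.\<close>

lemma sq_length3_eq:
  assumes T: "trilinear T"
  shows "sq_length3 g T =
    ((T e1 e1 e1)\<^sup>2 + (T e1 e1 e2)\<^sup>2 - (T e1 e1 e3)\<^sup>2)
    + ((T e1 e2 e1)\<^sup>2 + (T e1 e2 e2)\<^sup>2 - (T e1 e2 e3)\<^sup>2)
    - ((T e1 e3 e1)\<^sup>2 + (T e1 e3 e2)\<^sup>2 - (T e1 e3 e3)\<^sup>2)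
    + ((T e2 e1 e1)\<^sup>2 + (T e2 e1 e2)\<^sup>2 - (T e2 e1 e3)\<^sup>2)
    + ((T e2 e2 e1)\<^sup>2 + (T e2 e2 e2)\<^sup>2 - (T e2 e2 e3)\<^sup>2)
    - ((T e2 e3 e1)\<^sup>2 + (T e2 e3 e2)\<^sup>2 - (T e2 e3 e3)\<^sup>2)
    - ((T e3 e1 e1)\<^sup>2 + (T e3 e1 e2)\<^sup>2 - (T e3 e1 e3)\<^sup>2)
    - ((T e3 e2 e1)\<^sup>2 + (T e3 e2 e2)\<^sup>2 - (T e3 e2 e3)\<^sup>2)
    + ((T e3 e3 e1)\<^sup>2 + (T e3 e3 e2)\<^sup>2 - (T e3 e3 e3)\<^sup>2)"
proof -
  note T_simps = trilinearD[OF T]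
  have z: "metric_trace g (\<lambda>z z'. T x y z * T x' y' z') = T x y e1 * T x' y' e1
      + T x y e2 * T x' y' e2 - T x y e3 * T x' y' e3" for x x' y y'
    by (rule metric_trace_eq, rule bilinearI) (simp_all add: T_simps algebra_simps)
  have y: "metric_trace g (\<lambda>y y'. T x y e1 * T x' y' e1
      + T x y e2 * T x' y' e2 - T x y e3 * T x' y' e3) =
      (T x e1 e1 * T x' e1 e1 + T x e1 e2 * T x' e1 e2 - T x e1 e3 * T x' e1 e3)
      + (T x e2 e1 * T x' e2 e1 + T x e2 e2 * T x' e2 e2 - T x e2 e3 * T x' e2 e3)
      - (T x e3 e1 * T x' e3 e1 + T x e3 e2 * T x' e3 e2 - T x e3 e3 * T x' e3 e3)" for x x'
    by (rule metric_trace_eq, rule bilinearI) (simp_all add: T_simps algebra_simps)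
  have "sq_length3 g T = metric_trace g (\<lambda>x x'.
      (T x e1 e1 * T x' e1 e1 + T x e1 e2 * T x' e1 e2 - T x e1 e3 * T x' e1 e3)
      + (T x e2 e1 * T x' e2 e1 + T x e2 e2 * T x' e2 e2 - T x e2 e3 * T x' e2 e3)
      - (T x e3 e1 * T x' e3 e1 + T x e3 e2 * T x' e3 e2 - T x e3 e3 * T x' e3 e3))"
    unfolding sq_length3_def z y ..
  also have "\<dots> =
      (T e1 e1 e1 * T e1 e1 e1 + T e1 e1 e2 * T e1 e1 e2 - T e1 e1 e3 * T e1 e1 e3)
      + (T e1 e2 e1 * T e1 e2 e1 + T e1 e2 e2 * T e1 e2 e2 - T e1 e2 e3 * T e1 e2 e3)
      - (T e1 e3 e1 * T e1 e3 e1 + T e1 e3 e2 * T e1 e3 e2 - T e1 e3 e3 * T e1 e3 e3)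
    + ((T e2 e1 e1 * T e2 e1 e1 + T e2 e1 e2 * T e2 e1 e2 - T e2 e1 e3 * T e2 e1 e3)
      + (T e2 e2 e1 * T e2 e2 e1 + T e2 e2 e2 * T e2 e2 e2 - T e2 e2 e3 * T e2 e2 e3)
      - (T e2 e3 e1 * T e2 e3 e1 + T e2 e3 e2 * T e2 e3 e2 - T e2 e3 e3 * T e2 e3 e3))
    - ((T e3 e1 e1 * T e3 e1 e1 + T e3 e1 e2 * T e3 e1 e2 - T e3 e1 e3 * T e3 e1 e3)
      + (T e3 e2 e1 * T e3 e2 e1 + T e3 e2 e2 * T e3 e2 e2 - T e3 e2 e3 * T e3 e2 e3)
      - (T e3 e3 e1 * T e3 e3 e1 + T e3 e3 e2 * T e3 e3 e2 - T e3 e3 e3 * T e3 e3 e3))"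
    by (rule metric_trace_eq, rule bilinearI) (simp_all add: T_simps algebra_simps)
  finally show ?thesis
    by (simp add: power2_eq_square)
qed

lemma trilinear_eq_0:
  fixes T :: "'a \<Rightarrow> 'a \<Rightarrow> 'a \<Rightarrow> 'b::real_vector"
  assumes T: "trilinear T"
    and 0: "\<And>u v w. \<lbrakk>u \<in> {e1, e2, e3}; v \<in> {e1, e2, e3}; w \<in> {e1, e2, e3}\<rbrakk> \<Longrightarrow> T u v w = 0"
  shows "T = (\<lambda>x y z. 0)"
proof (intro ext)
  fix x y z
  have lin: "linear (\<lambda>x. T x y z)" "linear (\<lambda>y. T x y z)" "linear (\<lambda>z. T x y z)" for x y z
    using T by (auto simp: trilinear_def)
  have 1: "T u v z = 0" if "u \<in> {e1, e2, e3}" "v \<in> {e1, e2, e3}" for u v z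
    by (rule linear_frame_eqI[OF lin(3) linear_zero]) (use 0 that in simp_all)
  have 2: "T u y z = 0" if "u \<in> {e1, e2, e3}" for u y z
    by (rule linear_frame_eqI[OF lin(2) linear_zero]) (use 1 that in simp_all)
  show "T x y z = 0"
    by (rule linear_frame_eqI[OF lin(1) linear_zero]) (use 2 in simp_all)
qed

end

section \<open>Connection, curvature and Schouten-Weyl tensor in a frame\<close>

locale metric_lie_frame = lorentz_frame g e1 e2 e3
  for g :: "'a::real_vector \<Rightarrow> 'a \<Rightarrow> real" and e1 e2 e3 :: 'a +
  fixes br :: "'a \<Rightarrow> 'a \<Rightarrow> 'a"
  assumes bilinear_br: "bilinear br"
    and br_self [simp]: "br x x = 0"
    and dim3: "dim (UNIV :: 'a set) = 3"
begin

lemmas br_simps = bilinear_simps[OF bilinear_br]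

lemma br_antisym: "br x y = - br y x"
proof -
  have "br (x + y) (x + y) = br x x + br y x + (br x y + br y y)"
    by (simp only: br_simps)
  then show ?thesis by (simp add: eq_neg_iff_add_eq_0 add.commute)
qed

text \<open>The Koszul formula for \<open>g (D x y) z\<close>. Its derivative terms are absent
  because products of left-invariant fields are constant.\<close>

definition koszul :: "'a \<Rightarrow> 'a \<Rightarrow> 'a \<Rightarrow> real" where
  "koszul x y z = (g (br x y) z - g (br y z) x + g (br z x) y) / 2"

text \<open>The vector obtained by raising the index of \<open>koszul x y\<close>, written out in
  the frame.\<close>

definition nabla :: "'a \<Rightarrow> 'a \<Rightarrow> 'a" where
  "nabla x y = koszul x y e1 *\<^sub>R e1 + koszul x y e2 *\<^sub>R e2 - koszul x y e3 *\<^sub>R e3"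

lemma trilinear_koszul: "trilinear koszul"
  by (rule trilinearI)
    (simp_all add: koszul_def g_simps br_simps add_divide_distrib diff_divide_distrib algebra_simps)

lemma g_nabla: "g (nabla x y) z = koszul x y z"
proof -
  have "linear (koszul x y)" using trilinear_koszul by (simp add: trilinear_def)
  from linear_expansion[OF this, of z] show ?thesis
    by (simp add: nabla_def g_simps g_sym[of _ z] mult.commute)
qed

lemma bilinear_nabla: "bilinear nabla"
  by (rule bilinearI) (simp_all add: nabla_def trilinearD[OF trilinear_koszul] algebra_simps)

lemmas nabla_simps = bilinear_simps[OF bilinear_nabla]

lemma levi_civita_eq: "levi_civita br g = nabla"
  unfolding levi_civita_def
proof (rule the_equality)
  have "g (nabla x y - nabla y x) z = g (br x y) z" for x y z
    by (simp add: g_simps g_nabla koszul_def br_antisym[of y x] br_antisym[of y z]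
        br_antisym[of z x] field_simps)
  then have "nabla x y - nabla y x = br x y" for x y
    by (intro frame_eqI)
  moreover have "g (nabla x y) z + g y (nabla x z) = 0" for x y z
    by (simp add: g_sym[of y] g_nabla koszul_def g_simps br_antisym[of y x] br_antisym[of z y]
        br_antisym[of z x] field_simps)
  ultimately show "is_levi_civita br g nabla"
    using bilinear_nabla by (simp add: is_levi_civita_def)
next
  fix D assume D: "is_levi_civita br g D"
  have tor: "br x y = D x y - D y x" for x y
    using D by (simp add: is_levi_civita_def)
  have met: "g (D x y) z = - g (D x z) y" for x y z
    using D g_sym unfolding is_levi_civita_def by (metis add.inverse_unique add.commute minus_minus)
  \<comment> \<open>With brackets replaced by torsion, metric compatibility cancels the terms
    differentiated along \<open>y\<close> and \<open>z\<close> and makes the two along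
    \<open>x\<close> equal.\<close>
  have "koszul x y z = g (D x y) z" for x y z
    using met[of x y z] met[of y x z] met[of z x y]
    by (simp add: koszul_def tor g_simps)
  then have "D x y = nabla x y" for x y
    by (intro frame_eqI) (simp_all add: g_nabla)
  then show "D = nabla" by blast
qed

lemma curvature_eq:
  "curvature br g x y z = nabla y (nabla x z) - nabla x (nabla y z) + nabla (br x y) z"
  by (simp add: curvature_def levi_civita_eq Let_def)

lemma ricci_eq:
  "ricci br g x y = g (curvature br g x e1 y) e1 + g (curvature br g x e2 y) e2
     - g (curvature br g x e3 y) e3"
  unfolding ricci_def
  by (rule endo_trace_frame, rule linearI) (simp_all add: curvature_eq nabla_simps br_simps algebra_simps)

lemma bilinear_ricci: "bilinear (ricci br g)"
  by (rule bilinearI)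
    (simp_all add: ricci_eq curvature_eq nabla_simps br_simps g_simps algebra_simps)

text \<open>In dimension 3 the factor 1/(n-2) is 1 and 2(n-1) is 4; the bracketed sum is the scalar
  curvature.\<close>

lemma curvature_A_eq:
  "curvature_A br g x y = ricci br g x y -
     (ricci br g e1 e1 + ricci br g e2 e2 - ricci br g e3 e3) * g x y / 4"
  by (simp add: curvature_A_def dim3 scalar_curvature_def metric_trace_eq[OF bilinear_ricci])

lemma bilinear_curvature_A: "bilinear (curvature_A br g)"
  by (rule bilinearI)
    (simp_all add: curvature_A_eq bilinear_simps[OF bilinear_ricci] g_simps add_divide_distrib
      diff_divide_distrib algebra_simps)

lemmas curvature_A_simps = bilinear_simps[OF bilinear_curvature_A]

lemma schouten_weyl_eq:
  "schouten_weyl br g x y z =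
     curvature_A br g (nabla y x) z + curvature_A br g x (nabla y z)
     - curvature_A br g (nabla z x) y - curvature_A br g x (nabla z y)"
  by (simp add: schouten_weyl_def cov_deriv_def levi_civita_eq)

lemma trilinear_schouten_weyl: "trilinear (schouten_weyl br g)"
  by (rule trilinearI)
    (simp_all add: schouten_weyl_eq curvature_A_simps nabla_simps algebra_simps)

lemma schouten_weyl_antisym:
  "schouten_weyl br g x y z = - schouten_weyl br g x z y"
  by (simp add: schouten_weyl_eq)

lemma schouten_weyl_diag: "schouten_weyl br g x y y = 0"
  by (simp add: schouten_weyl_eq)

text \<open>By antisymmetry in the last two slots nine components determine \<open>SW\<close>. Each
  of their squares occurs twice in the squared length, and the common factor 2 is divided
  out.\<close>

lemma schouten_weyl_isotropic_frame:
  fixes SW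
  assumes "isotropic3 g (schouten_weyl br g)"
  defines "SW \<equiv> schouten_weyl br g"
  shows "(SW e1 e1 e2)\<^sup>2 - (SW e1 e1 e3)\<^sup>2 - (SW e1 e2 e3)\<^sup>2
      + (SW e2 e1 e2)\<^sup>2 - (SW e2 e1 e3)\<^sup>2 - (SW e2 e2 e3)\<^sup>2
      - (SW e3 e1 e2)\<^sup>2 + (SW e3 e1 e3)\<^sup>2 + (SW e3 e2 e3)\<^sup>2 = 0"
    and "\<exists>u\<in>{e1, e2, e3}. SW u e1 e2 \<noteq> 0 \<or> SW u e1 e3 \<noteq> 0 \<or> SW u e2 e3 \<noteq> 0"
proof -
  note anti = schouten_weyl_antisym[of _ e2 e1] schouten_weyl_antisym[of _ e3 e1]
    schouten_weyl_antisym[of _ e3 e2] schouten_weyl_diag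
  have "sq_length3 g SW = 0" and ne: "SW \<noteq> (\<lambda>x y z. 0)"
    using assms(1) by (auto simp: isotropic3_def SW_def)
  then show "(SW e1 e1 e2)\<^sup>2 - (SW e1 e1 e3)\<^sup>2 - (SW e1 e2 e3)\<^sup>2
      + (SW e2 e1 e2)\<^sup>2 - (SW e2 e1 e3)\<^sup>2 - (SW e2 e2 e3)\<^sup>2
      - (SW e3 e1 e2)\<^sup>2 + (SW e3 e1 e3)\<^sup>2 + (SW e3 e2 e3)\<^sup>2 = 0"
    by (simp add: SW_def sq_length3_eq[OF trilinear_schouten_weyl] anti)
  show "\<exists>u\<in>{e1, e2, e3}. SW u e1 e2 \<noteq> 0 \<or> SW u e1 e3 \<noteq> 0 \<or> SW u e2 e3 \<noteq> 0"
  proof (rule ccontr)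
    assume "\<not> ?thesis"
    then have "SW u v w = 0"
      if "u \<in> {e1, e2, e3}" "v \<in> {e1, e2, e3}" "w \<in> {e1, e2, e3}" for u v w
      using that by (auto simp: SW_def anti)
    then have "SW = (\<lambda>x y z. 0)"
      using trilinear_eq_0[OF trilinear_schouten_weyl] by (simp add: SW_def)
    with ne show False by contradiction
  qed
qed


text \<open>Both sides of the homomorphism law are bilinear and alternating, so three brackets of
  frame vectors suffice; an explicit inverse \<open>h\<close> on \<open>S\<close> gives
  bijectivity.\<close>

lemma lie_isomorphic_toI:
  assumes f: "linear f" and fS: "\<And>x. f x \<in> S"
    and left: "\<And>x. h (f x) = x" and right: "\<And>X. X \<in> S \<Longrightarrow> f (h X) = X"
    and hom: "f (br e1 e2) = commutator (f e1) (f e2)" "f (br e1 e3) = commutator (f e1) (f e3)"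
      "f (br e2 e3) = commutator (f e2) (f e3)"
  shows "lie_isomorphic_to br S"
proof -
  have "bij_betw f UNIV S"
    by (rule bij_betw_byWitness[where f' = h]) (use fS left right in auto)
  moreover have "f (br x y) = commutator (f x) (f y)" for x y
  proof -
    note f_simps = linear_add[OF f] linear_scale[OF f] linear_neg[OF f] linear_0[OF f]
    have lin1: "linear (\<lambda>y. f (br x y))" "linear (\<lambda>x. f (br x y))" for x y
      by (rule linearI; simp add: br_simps f_simps)+
    have lin2: "linear (\<lambda>y. commutator (f x) (f y))" "linear (\<lambda>x. commutator (f x) (f y))" for x y
      by (rule linearI; simp add: f_simps commutator_def matrix_matrix_mult_def vec_eq_iff
          sum.distrib sum_distrib_left algebra_simps)+
    have anti: "commutator (f x) (f y) = - commutator (f y) (f x)" for x y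
      by (simp add: commutator_def)
    have diag: "commutator X X = 0" for X
      by (simp add: commutator_def)
    have frame: "f (br u v) = commutator (f u) (f v)"
      if "u \<in> {e1, e2, e3}" "v \<in> {e1, e2, e3}" for u v
      using that hom br_antisym[of e2 e1] br_antisym[of e3 e1] br_antisym[of e3 e2]
        anti[of e2 e1] anti[of e3 e1] anti[of e3 e2]
      by (auto simp: diag f_simps)
    have "f (br u y) = commutator (f u) (f y)" if "u \<in> {e1, e2, e3}" for u y
      by (rule linear_frame_eqI[OF lin1(1) lin2(1)]) (use frame that in simp_all)
    then show ?thesis
      by (rule linear_frame_eqI[OF lin1(2) lin2(2)]; simp)
  qed
  ultimately show ?thesis
    using f by (auto simp: lie_isomorphic_to_def)
qed

end

section \<open>Metric Lie algebras of type A2\<close>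

locale frame_A2 = metric_lie_frame +
  fixes l1 l2 :: real
  assumes br12: "br e1 e2 = (1 - l2) *\<^sub>R e3 - e2"
    and br13: "br e1 e3 = e3 - (1 + l2) *\<^sub>R e2"
    and br23: "br e2 e3 = l1 *\<^sub>R e1"
begin

lemmas br_frame = br12 br13 br23 br_antisym[of e2 e1, unfolded br12]
  br_antisym[of e3 e1, unfolded br13] br_antisym[of e3 e2, unfolded br23]

lemma nabla_frame:
  "nabla e1 e1 = 0"
  "nabla e1 e2 = (l1/2 - l2) *\<^sub>R e3"
  "nabla e1 e3 = (l1/2 - l2) *\<^sub>R e2"
  "nabla e2 e1 = e2 + (l1/2 - 1) *\<^sub>R e3"
  "nabla e2 e2 = - e1"
  "nabla e2 e3 = (l1/2 - 1) *\<^sub>R e1"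
  "nabla e3 e1 = (1 + l1/2) *\<^sub>R e2 - e3"
  "nabla e3 e2 = - (1 + l1/2) *\<^sub>R e1"
  "nabla e3 e3 = - e1"
  by (rule frame_eqI; simp add: g_nabla koszul_def br_frame g_simps field_simps)+

text \<open>Both orders of the arguments are listed, since symmetry is not visible in the definition
  of \<open>ricci\<close> and later expansions meet both.\<close>

lemma ricci_frame:
  "ricci br g e1 e1 = - l1\<^sup>2 / 2"
  "ricci br g e1 e2 = 0"
  "ricci br g e1 e3 = 0"
  "ricci br g e2 e1 = 0"
  "ricci br g e2 e2 = l1 - 2 * l2 - l1 * l2 + l1\<^sup>2 / 2"
  "ricci br g e2 e3 = l1 - 2 * l2"
  "ricci br g e3 e1 = 0"
  "ricci br g e3 e2 = l1 - 2 * l2"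
  "ricci br g e3 e3 = l1 - 2 * l2 + l1 * l2 - l1\<^sup>2 / 2"
  by (simp_all add: ricci_eq curvature_eq br_frame nabla_simps nabla_frame g_simps
      power2_eq_square field_simps)

lemma curvature_A_frame:
  "curvature_A br g e1 e1 = l1 * l2 / 2 - 5/8 * l1\<^sup>2"
  "curvature_A br g e1 e2 = 0"
  "curvature_A br g e1 e3 = 0"
  "curvature_A br g e2 e1 = 0"
  "curvature_A br g e2 e2 = l1 - 2 * l2 - l1 * l2 / 2 + 3/8 * l1\<^sup>2"
  "curvature_A br g e2 e3 = l1 - 2 * l2"
  "curvature_A br g e3 e1 = 0"
  "curvature_A br g e3 e2 = l1 - 2 * l2"
  "curvature_A br g e3 e3 = l1 - 2 * l2 + l1 * l2 / 2 - 3/8 * l1\<^sup>2"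
  by (simp_all add: curvature_A_eq ricci_frame field_simps)

lemma schouten_weyl_frame:
  "schouten_weyl br g e1 e1 e2 = 0"
  "schouten_weyl br g e1 e1 e3 = 0"
  "schouten_weyl br g e1 e2 e3 = l1\<^sup>2 * (l2 - l1)"
  "schouten_weyl br g e2 e1 e2 = 4 * l2\<^sup>2 - 2 * l1 * l2 - l1\<^sup>2 / 2"
  "schouten_weyl br g e2 e1 e3 = 4 * l2\<^sup>2 - 2 * l1 * l2 - l1\<^sup>2 / 2 + l1\<^sup>2 * (l2 - l1) / 2"
  "schouten_weyl br g e2 e2 e3 = 0"
  "schouten_weyl br g e3 e1 e2 = 4 * l2\<^sup>2 - 2 * l1 * l2 - l1\<^sup>2 / 2 - l1\<^sup>2 * (l2 - l1) / 2"
  "schouten_weyl br g e3 e1 e3 = 4 * l2\<^sup>2 - 2 * l1 * l2 - l1\<^sup>2 / 2"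
  "schouten_weyl br g e3 e2 e3 = 0"
  by (simp_all add: schouten_weyl_eq nabla_frame curvature_A_simps curvature_A_frame
      power2_eq_square field_simps)

lemma isotropic_parameters:
  assumes "isotropic3 g (schouten_weyl br g)"
  shows "l2 \<noteq> 0 \<and> (l1 = 0 \<or> l1 = l2)"
proof -
  \<comment> \<open>The nine components of \<open>SW\<close> take only the values 0,
    \<open>c\<close>, \<open>k\<close>, \<open>k + c/2\<close> and \<open>k - c/2\<close>.\<close>
  define k where "k = 4 * l2\<^sup>2 - 2 * l1 * l2 - l1\<^sup>2 / 2"
  define c where "c = l1\<^sup>2 * (l2 - l1)"
  note SW = schouten_weyl_frame[folded k_def c_def]
  \<comment> \<open>The signed sum is \<open>2 * k\<^sup>2 - c\<^sup>2 - (k + c/2)\<^sup>2 - (k -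
    c/2)\<^sup>2 = - 3/2 * c\<^sup>2\<close>.\<close>
  have "c\<^sup>2 = 0"
    using schouten_weyl_isotropic_frame(1)[OF assms]
    by (simp add: SW power2_eq_square field_simps)
  then have c: "c = 0" by simp
  have "k \<noteq> 0"
    using schouten_weyl_isotropic_frame(2)[OF assms] by (auto simp: SW c)
  \<comment> \<open>From \<open>c = 0\<close> follows \<open>l1 = 0\<close> or
    \<open>l1 = l2\<close>; then \<open>k\<close> is \<open>4 * l2\<^sup>2\<close> or
    \<open>3/2 * l2\<^sup>2\<close> respectively, hence \<open>l2\<close> is nonzero.\<close>
  then show ?thesis
    using c by (auto simp: c_def k_def)
qed

text \<open>On \<open>span {e2, e3}\<close> the operator \<open>ad e1\<close> has eigenvalues \<open>\<plusminus>l2\<close>, with left eigenvectors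
  \<open>(1 - l2, 1 + l2)\<close> and \<open>(1, 1)\<close>; these give the matrix entries of both isomorphisms below.\<close>

lemma isomorphic_e11:
  assumes "l1 = 0" "l2 \<noteq> 0"
  shows "lie_isomorphic_to br e11"
proof (rule lie_isomorphic_toI)
  \<comment> \<open>A boost is diagonal in the sum and difference of the two translation entries.
    Here these are twice the two left eigenvectors applied to the coordinates \<open>g x e2\<close>
    and \<open>- g x e3\<close>.\<close>
  let ?f = "\<lambda>x. vector [vector [0, l2 * g x e1, (2 - l2) * g x e2 - (2 + l2) * g x e3],
    vector [l2 * g x e1, 0, - l2 * g x e2 - l2 * g x e3], vector [0, 0, 0]] :: real^3^3"
  let ?h = "\<lambda>X::real^3^3. (X$1$2 / l2) *\<^sub>R e1
    + ((l2 * X$1$3 - (2 + l2) * X$2$3) / (4 * l2)) *\<^sub>R e2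
    + ((l2 * X$1$3 + (2 - l2) * X$2$3) / (4 * l2)) *\<^sub>R e3"
  show "linear ?f"
    by (rule linearI) (simp_all add: vec_eq_iff forall_3 g_simps algebra_simps)
  show "?f x \<in> e11" for x
    unfolding e11_def by blast
  show "?h (?f x) = x" for x
    by (rule frame_eqI) (simp_all add: g_simps assms field_simps)
  show "?f (?h X) = X" if "X \<in> e11" for X
    using that by (auto simp: e11_def vec_eq_iff forall_3 g_simps assms field_simps)
qed (simp_all add: br_frame commutator_def matrix_matrix_mult_def vec_eq_iff forall_3 sum_3
    g_simps assms algebra_simps)

lemma isomorphic_sl2:
  assumes "l1 = l2" "l2 \<noteq> 0"
  shows "lie_isomorphic_to br sl2"
proof (rule lie_isomorphic_toI)
  \<comment> \<open>The left eigenvectors fill the off-diagonal entries. The scale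
    \<open>- l2 / 4\<close> is forced by \<open>[e2, e3] = l2 e1\<close>: their determinant
    \<open>2 * l2\<close> times \<open>l2 / 4\<close> must be \<open>l2\<^sup>2 / 2\<close>, the
    upper left entry of the image of \<open>l2 e1\<close>.\<close>
  let ?f = "\<lambda>x. vector [vector [l2 / 2 * g x e1, (1 - l2) * g x e2 - (1 + l2) * g x e3],
    vector [- l2 / 4 * (g x e2 - g x e3), - l2 / 2 * g x e1]] :: real^2^2"
  let ?h = "\<lambda>X::real^2^2. (2 * X$1$1 / l2) *\<^sub>R e1
    + ((- 4 * X$2$1 / l2 - (X$1$2 + 4 * X$2$1 / l2) / l2) / 2) *\<^sub>R e2
    + ((- 4 * X$2$1 / l2 + (X$1$2 + 4 * X$2$1 / l2) / l2) / 2) *\<^sub>R e3"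
  show "linear ?f"
    by (rule linearI) (simp_all add: vec_eq_iff forall_2 g_simps algebra_simps)
  show "?f x \<in> sl2" for x
    by (simp add: sl2_def trace_def sum_2)
  show "?h (?f x) = x" for x
    by (rule frame_eqI) (simp_all add: g_simps assms field_simps)
  show "?f (?h X) = X" if "X \<in> sl2" for X
    using that by (simp add: sl2_def trace_def sum_2 vec_eq_iff forall_2 g_simps assms field_simps)
qed (simp_all add: br_frame commutator_def matrix_matrix_mult_def vec_eq_iff forall_2 sum_2
    g_simps assms field_simps)

end

section \<open>Metric Lie algebras of type A3\<close>

locale frame_A3 = metric_lie_frame +
  fixes l :: real
  assumes br12: "br e1 e2 = e1 - l *\<^sub>R e3"
    and br13: "br e1 e3 = - (l *\<^sub>R e2) - e1"
    and br23: "br e2 e3 = l *\<^sub>R e1 + e2 + e3"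
begin

lemmas br_frame = br12 br13 br23 br_antisym[of e2 e1, unfolded br12]
  br_antisym[of e3 e1, unfolded br13] br_antisym[of e3 e2, unfolded br23]

lemma nabla_frame:
  "nabla e1 e1 = - e2 - e3"
  "nabla e1 e2 = e1 - (l/2) *\<^sub>R e3"
  "nabla e1 e3 = - e1 - (l/2) *\<^sub>R e2"
  "nabla e2 e1 = (l/2) *\<^sub>R e3"
  "nabla e2 e2 = e3"
  "nabla e2 e3 = (l/2) *\<^sub>R e1 + e2"
  "nabla e3 e1 = (l/2) *\<^sub>R e2"
  "nabla e3 e2 = - (l/2) *\<^sub>R e1 - e3"
  "nabla e3 e3 = - e2"
  by (rule frame_eqI; simp add: g_nabla koszul_def br_frame g_simps field_simps)+

lemma ricci_frame:
  "ricci br g e1 e1 = - l\<^sup>2 / 2"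
  "ricci br g e1 e2 = - l"
  "ricci br g e1 e3 = l"
  "ricci br g e2 e1 = - l"
  "ricci br g e2 e2 = - 2 - l\<^sup>2 / 2"
  "ricci br g e2 e3 = 2"
  "ricci br g e3 e1 = l"
  "ricci br g e3 e2 = 2"
  "ricci br g e3 e3 = - 2 + l\<^sup>2 / 2"
  by (simp_all add: ricci_eq curvature_eq br_frame nabla_simps nabla_frame g_simps
      power2_eq_square field_simps)

lemma curvature_A_frame:
  "curvature_A br g e1 e1 = - l\<^sup>2 / 8"
  "curvature_A br g e1 e2 = - l"
  "curvature_A br g e1 e3 = l"
  "curvature_A br g e2 e1 = - l"
  "curvature_A br g e2 e2 = - 2 - l\<^sup>2 / 8"
  "curvature_A br g e2 e3 = 2"
  "curvature_A br g e3 e1 = l"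
  "curvature_A br g e3 e2 = 2"
  "curvature_A br g e3 e3 = - 2 + l\<^sup>2 / 8"
  by (simp_all add: curvature_A_eq ricci_frame field_simps)

text \<open>For \<open>l = 0\<close> the tensor \<open>A\<close> is -2 times the square of the
  covector \<theta> dual to the null vector \<open>n = e2 + e3\<close>. Moreover
  \<open>nabla z n\<close> is \<theta>(z) times \<open>n\<close>, so the covariant derivative of
  \<open>A\<close> is totally symmetric and its antisymmetrisation vanishes.\<close>

lemma schouten_weyl_frame_0:
  assumes "l = 0" "u \<in> {e1, e2, e3}"
  shows "schouten_weyl br g u e1 e2 = 0" "schouten_weyl br g u e1 e3 = 0"
    "schouten_weyl br g u e2 e3 = 0"
  using assms
  by (auto simp: schouten_weyl_eq nabla_frame curvature_A_simps curvature_A_frame)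

lemma isotropic_parameter:
  assumes "isotropic3 g (schouten_weyl br g)"
  shows "l \<noteq> 0"
  using schouten_weyl_isotropic_frame(2)[OF assms] schouten_weyl_frame_0 by blast

text \<open>The matrices realise \<open>e1\<close> as \<open>- l/2 H\<close>, its eigenvector \<open>e2 + e3\<close> as \<open>E\<close> and its
  eigenvector \<open>e2 - e3 + 2/l e1\<close> as \<open>l\<^sup>2 F\<close>, where \<open>H, E, F\<close> is the standard basis of \<open>sl2\<close>.\<close>

lemma isomorphic_sl2:
  assumes "l \<noteq> 0"
  shows "lie_isomorphic_to br sl2"
proof (rule lie_isomorphic_toI)
  \<comment> \<open>The term \<open>(g x e2 + g x e3) / 2\<close> on the diagonal appears because
    \<open>e2 - e3\<close> is not an eigenvector: subtracting \<open>2/l e1\<close> from the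
    eigenvector sends it to \<open>l\<^sup>2 F + H\<close>.\<close>
  let ?f = "\<lambda>x. vector [vector [- l / 2 * g x e1 + (g x e2 + g x e3) / 2, (g x e2 - g x e3) / 2],
    vector [l\<^sup>2 * (g x e2 + g x e3) / 2, l / 2 * g x e1 - (g x e2 + g x e3) / 2]] :: real^2^2"
  let ?h = "\<lambda>X::real^2^2. (2 / l * (X$2$1 / l\<^sup>2 - X$1$1)) *\<^sub>R e1
    + (X$1$2 + X$2$1 / l\<^sup>2) *\<^sub>R e2 + (X$1$2 - X$2$1 / l\<^sup>2) *\<^sub>R e3"
  show "linear ?f"
    by (rule linearI) (simp_all add: vec_eq_iff forall_2 g_simps field_simps)
  show "?f x \<in> sl2" for x
    by (simp add: sl2_def trace_def sum_2)
  show "?h (?f x) = x" for x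
    by (rule frame_eqI) (simp_all add: g_simps assms field_simps)
  show "?f (?h X) = X" if "X \<in> sl2" for X
    using that by (simp add: sl2_def trace_def sum_2 vec_eq_iff forall_2 g_simps assms field_simps)
qed (simp_all add: br_frame commutator_def matrix_matrix_mult_def vec_eq_iff forall_2 sum_2
    g_simps assms field_simps power2_eq_square)

end

theorem theorem3p1:
  fixes br :: "'a::real_vector \<Rightarrow> 'a \<Rightarrow> 'a"
    and g :: "'a \<Rightarrow> 'a \<Rightarrow> real"
    and l1 l2 l :: real
  assumes "lie_algebra br"
    and "dim (UNIV :: 'a set) = 3"
    and "unimodular br"
    and "lorentzian g"
    and "type_A2 br g l1 l2 \<or> type_A3 br g l"
    and "isotropic3 g (schouten_weyl br g)"
  shows "(lie_isomorphic_to br e11 \<or> lie_isomorphic_to br sl2) \<and>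
     ((type_A2 br g l1 l2 \<and> l1 = 0 \<and> l2 \<noteq> 0 \<and> lie_isomorphic_to br e11) \<or>
      (type_A2 br g l1 l2 \<and> l1 = l2 \<and> l2 \<noteq> 0 \<and> lie_isomorphic_to br sl2) \<or>
      (type_A3 br g l \<and> l \<noteq> 0 \<and> lie_isomorphic_to br sl2))"
proof -
  from assms(1) have br: "bilinear br" "\<And>x. br x x = 0"
    by (auto simp: lie_algebra_def)
  from assms(4) have g: "bilinear g" "\<And>x y. g x y = g y x"
    by (auto simp: lorentzian_def)
  \<comment> \<open>The frame used below is the one witnessing the type, as the bracket formulas
    hold there; the basis provided by \<open>lorentzian\<close> may be a different one.\<close>
  have frame: "metric_lie_frame g e1 e2 e3 br" if "pseudo_orthonormal_basis g e1 e2 e3" for e1 e2 e3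
    using br g assms(2) that
    by (auto simp: metric_lie_frame_def metric_lie_frame_axioms_def lorentz_frame_def)
  show ?thesis
    using assms(5)
  proof
    assume A2: "type_A2 br g l1 l2"
    then obtain e1 e2 e3 where "pseudo_orthonormal_basis g e1 e2 e3"
      "br e1 e2 = (1 - l2) *\<^sub>R e3 - e2" "br e1 e3 = e3 - (1 + l2) *\<^sub>R e2" "br e2 e3 = l1 *\<^sub>R e1"
      by (auto simp: type_A2_def)
    then interpret frame_A2 g e1 e2 e3 br l1 l2
      by (simp add: frame frame_A2_def frame_A2_axioms_def)
    show ?thesis
      using A2 isotropic_parameters[OF assms(6)] isomorphic_e11 isomorphic_sl2 by auto
  next
    assume A3: "type_A3 br g l"
    then obtain e1 e2 e3 where "pseudo_orthonormal_basis g e1 e2 e3"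
      "br e1 e2 = e1 - l *\<^sub>R e3" "br e1 e3 = - (l *\<^sub>R e2) - e1"
      "br e2 e3 = l *\<^sub>R e1 + e2 + e3"
      by (auto simp: type_A3_def)
    then interpret frame_A3 g e1 e2 e3 br l
      by (simp add: frame frame_A3_def frame_A3_axioms_def)
    show ?thesis
      using A3 isotropic_parameter[OF assms(6)] isomorphic_sl2 by auto
  qed
qed

end
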